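(* Let $p \in [2,\infty)$, let $n \ge 1$ be an integer, and let $\xi(1),\ldots,\xi(n)$ be centered martingale differences with respect to a filtration $F(0)\subset F(1)\subset\cdots\subset F(n)$ on a probability space $(\Omega,F,{\bf P})$, with $\xi(i)\in L(p)$ for all $i$. Put $S(n)=\sum_{i=1}^n \xi(i)$. Then $$\left|n^{-1/2} S(n)\right|_p \le (p-1)\left\{ n^{-1}\sum_{i=1}^n |\xi(i)|_p^2\right\}^{1/2}.$$
   Context: For a real random variable $\eta$ on $(\Omega,F,{\bf P})$ and $p\in[1,\infty)$, $|\eta|_p=({\bf E}|\eta|^p)^{1/p}$, and $L(p)$ is the set of $\eta$ with $|\eta|_p<\infty$. Centered martingale differences with respect to the filtration $\{F(i)\}$, where $F(0)=\{\emptyset,\Omega\}$ and $F(i)\subset F(i+1)\subset F$, are integrable real random variables $\xi(i)$ such that ${\bf E}\xi(i)=0$, $\xi(i)$ is $F(i)$-measurable, and ${\bf E}(\xi(i)\mid F(k))=0$ almost surely for all $0\le k\le i-1$. *)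

theory Defs
  imports "HOL-Probability.Probability"
begin

text \<open>The index \<open>p\<close> is meant to lie in \<open>[1, \<infinity>)\<close>. Since the Bochner integral of a
  non-integrable function is \<open>0\<close>, the real number \<open>Lp_norm M p \<eta>\<close> is \<open>|\<eta>|\<^sub>p\<close> only for
  \<open>\<eta> \<in> Lp_set M p\<close>; the condition \<open>|\<eta>|\<^sub>p < \<infinity>\<close> is expressed by membership in \<open>Lp_set M p\<close>.\<close>

definition Lp_norm :: "'a measure \<Rightarrow> real \<Rightarrow> ('a \<Rightarrow> real) \<Rightarrow> real" where
  "Lp_norm M p \<eta> = (\<integral>\<omega>. \<bar>\<eta> \<omega>\<bar> powr p \<partial>M) powr (1 / p)"

definition Lp_set :: "'a measure \<Rightarrow> real \<Rightarrow> ('a \<Rightarrow> real) set" where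
  "Lp_set M p = {\<eta> \<in> borel_measurable M. integrable M (\<lambda>\<omega>. \<bar>\<eta> \<omega>\<bar> powr p)}"

text \<open>Unlike in the library locale \<open>filtration\<close>, only the \<open>\<sigma>\<close>-algebras \<open>F 0, \<dots>, F n\<close> are
  constrained. As in \<open>real_cond_exp\<close>, a sub-\<open>\<sigma>\<close>-algebra is given by a measure of which
  only the space and the measurable sets matter.\<close>

definition filtration_upto :: "'a measure \<Rightarrow> nat \<Rightarrow> (nat \<Rightarrow> 'a measure) \<Rightarrow> bool" where
  "filtration_upto M n F \<longleftrightarrow>
     sets (F 0) = {{}, space M} \<and>
     (\<forall>i\<le>n. subalgebra M (F i)) \<and>
     (\<forall>i<n. sets (F i) \<subseteq> sets (F (Suc i)))"

definition centered_martingale_differences ::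
  "'a measure \<Rightarrow> nat \<Rightarrow> (nat \<Rightarrow> 'a measure) \<Rightarrow> (nat \<Rightarrow> 'a \<Rightarrow> real) \<Rightarrow> bool" where
  "centered_martingale_differences M n F \<xi> \<longleftrightarrow>
     (\<forall>i\<in>{1..n}.
        integrable M (\<xi> i) \<and>
        (\<integral>\<omega>. \<xi> i \<omega> \<partial>M) = 0 \<and>
        \<xi> i \<in> borel_measurable (F i) \<and>
        (\<forall>k<i. AE \<omega> in M. real_cond_exp M (F k) (\<xi> i) \<omega> = 0))"

end

(* The L(p) norm is 2-smooth with constant p - 1: integrating Bonami's two-point inequality and
   using Minkowski's inequality in L(p/2) bounds the symmetric second differences of the square of
   the norm. For a conditionally centered increment y of x, the function t |-> |x + t y|_p is
   minimal at t = 0, because the tangent inequality for |.|^p has a first-order term of mean zero.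
   Second differences bounded by 2 (p - 1) |y|_p^2 s^2 then give
   |x + y|_p^2 <= |x|_p^2 + (p - 1) |y|_p^2. Summation over the increments yields the constant
   sqrt(p - 1), which is at most p - 1. *)

theory Submission
  imports Defs
begin

section \<open>Tangent inequality and convexity for the p-th power of the absolute value\<close>

text \<open>After expanding the linear term, this is Young's inequality for the product of
  \<open>\<bar>x\<bar> powr (p - 1)\<close> and \<open>\<bar>z\<bar>\<close> with exponents
  \<open>p / (p - 1)\<close> and \<open>p\<close>. The case \<open>p = 1\<close> is separate because
  the conjugate exponent is then infinite.\<close>

lemma abs_powr_tangent:
  fixes x z p :: real
  assumes "1 \<le> p"
  shows "\<bar>x\<bar> powr p + p * (sgn x * \<bar>x\<bar> powr (p - 1)) * (z - x) \<le> \<bar>z\<bar> powr p"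
proof (cases "x = 0")
  case True
  then show ?thesis by simp
next
  case False
  have pow: "\<bar>x\<bar> powr (p - 1) * \<bar>x\<bar> = \<bar>x\<bar> powr p"
    using False by (simp add: powr_diff)
  have young: "p * (\<bar>x\<bar> powr (p - 1) * \<bar>z\<bar>) \<le> (p - 1) * \<bar>x\<bar> powr p + \<bar>z\<bar> powr p"
  proof (cases "p = 1")
    case True
    then show ?thesis using False by simp
  next
    case False
    then have p: "1 < p" using assms by simp
    define q where "q = p / (p - 1)"
    have q: "1 < q" "1 / q + 1 / p = 1" "(p - 1) * q = p"
      using p by (auto simp: q_def field_simps)
    have "\<bar>x\<bar> powr (p - 1) * \<bar>z\<bar> \<le> (\<bar>x\<bar> powr (p - 1)) powr q / q + \<bar>z\<bar> powr p / p"
      by (rule Youngs_inequality) (use p q in auto)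
    also have "\<dots> = (p - 1) / p * \<bar>x\<bar> powr p + \<bar>z\<bar> powr p / p"
      using q(3) by (simp add: powr_powr) (simp add: q_def)
    finally show ?thesis
      using p by (simp add: field_simps)
  qed
  have "sgn x * x = \<bar>x\<bar>" by (simp add: abs_sgn mult.commute)
  then have "p * (sgn x * \<bar>x\<bar> powr (p - 1)) * (z - x)
      = p * (\<bar>x\<bar> powr (p - 1) * (sgn x * z)) - p * \<bar>x\<bar> powr p"
    unfolding pow[symmetric] by (simp add: algebra_simps)
  also have "\<dots> \<le> p * (\<bar>x\<bar> powr (p - 1) * \<bar>z\<bar>) - p * \<bar>x\<bar> powr p"
    using assms by (intro diff_right_mono mult_left_mono) (auto simp: sgn_if)
  finally show ?thesis using young by (simp add: algebra_simps)
qed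

text \<open>Two tangent inequalities based at the intermediate point \<open>m\<close> are averaged;
  their first-order terms cancel.\<close>

lemma convex_on_abs_powr:
  fixes p :: real
  assumes "1 \<le> p"
  shows "convex_on UNIV (\<lambda>x. \<bar>x\<bar> powr p)"
proof (rule convex_onI)
  fix t x y :: real
  assume t: "0 < t" "t < 1"
  define m where "m = (1 - t) * x + t * y"
  define d where "d = p * (sgn m * \<bar>m\<bar> powr (p - 1))"
  have "(1 - t) * (\<bar>m\<bar> powr p + d * (x - m)) + t * (\<bar>m\<bar> powr p + d * (y - m))
      \<le> (1 - t) * \<bar>x\<bar> powr p + t * \<bar>y\<bar> powr p"
    unfolding d_def using t assms by (intro add_mono mult_left_mono abs_powr_tangent) auto
  moreover have "(1 - t) * (\<bar>m\<bar> powr p + d * (x - m)) + t * (\<bar>m\<bar> powr p + d * (y - m))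
      = \<bar>m\<bar> powr p + d * ((1 - t) * x + t * y - m)"
    by (simp add: algebra_simps)
  ultimately show "\<bar>(1 - t) *\<^sub>R x + t *\<^sub>R y\<bar> powr p \<le> (1 - t) * \<bar>x\<bar> powr p + t * \<bar>y\<bar> powr p"
    by (simp add: m_def)
qed simp

section \<open>Bonami's two-point inequality\<close>

text \<open>If \<open>1 \<le> q * y\<close>, the left side is nonpositive. Otherwise both sides are
  positive, and the logarithm \<open>h\<close> of their quotient vanishes at 0 and is nonincreasing,
  because \<open>x \<le> q * x < 1\<close> on the interval.\<close>

lemma powr_odd_even_ratio:
  fixes q y :: real
  assumes "1 \<le> q" "0 < y" "y < 1"
  shows "(1 + y) powr q * (1 - q * y) \<le> (1 - y) powr q * (1 + q * y)"
proof (cases "q * y < 1")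
  case False
  have "(1 + y) powr q * (1 - q * y) \<le> 0"
    using False by (intro mult_nonneg_nonpos) auto
  also have "0 \<le> (1 - y) powr q * (1 + q * y)" using assms by simp
  finally show ?thesis .
next
  case True
  define h where "h = (\<lambda>y. q * ln (1 + y) - q * ln (1 - y) + ln (1 - q * y) - ln (1 + q * y))"
  have "h y \<le> h 0"
  proof (rule DERIV_nonpos_imp_nonincreasing[of 0 y h])
    fix x assume x: "0 \<le> x" "x \<le> y"
    have "q * x \<le> q * y" using x assms by (intro mult_left_mono) auto
    moreover have "1 * x \<le> q * x" using x assms by (intro mult_right_mono) auto
    ultimately have qx: "0 \<le> q * x" "q * x < 1" "x \<le> q * x" using x True by auto
    let ?D = "q * (1 / (1 + x)) - q * (- 1 / (1 - x)) + (- q) / (1 - q * x) - q / (1 + q * x)"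
    have "(h has_real_derivative ?D) (at x)"
      unfolding h_def using x assms qx by (auto intro!: derivative_eq_intros)
    moreover have "?D = 2 * q * (1 / (1 - x\<^sup>2) - 1 / (1 - (q * x)\<^sup>2))"
    proof -
      have "1 / (1 + x) + 1 / (1 - x) = 2 / (1 - x\<^sup>2)"
        "1 / (1 + q * x) + 1 / (1 - q * x) = 2 / (1 - (q * x)\<^sup>2)"
        using x qx assms by (simp_all add: field_simps power2_eq_square)
      moreover have "?D = q * (1 / (1 + x) + 1 / (1 - x)) - q * (1 / (1 + q * x) + 1 / (1 - q * x))"
        by (simp add: algebra_simps)
      ultimately show ?thesis by (simp add: algebra_simps)
    qed
    moreover
    have "1 / (1 - x\<^sup>2) \<le> 1 / (1 - (q * x)\<^sup>2)"
      using qx x by (intro divide_left_mono mult_pos_pos)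
        (auto simp: power_mono abs_square_less_1 intro!: power_mono)
    then have "2 * q * (1 / (1 - x\<^sup>2) - 1 / (1 - (q * x)\<^sup>2)) \<le> 0"
      using assms by (intro mult_nonneg_nonpos) auto
    ultimately show "\<exists>D. (h has_real_derivative D) (at x) \<and> D \<le> 0"
      by (intro exI[of _ ?D] conjI) (simp_all only:)
  qed (use assms in simp)
  then have "q * ln (1 + y) + ln (1 - q * y) \<le> q * ln (1 - y) + ln (1 + q * y)"
    by (simp add: h_def)
  moreover have pos: "0 < 1 + q * y" using assms by (simp add: add_pos_pos)
  ultimately have "ln ((1 + y) powr q * (1 - q * y)) \<le> ln ((1 - y) powr q * (1 + q * y))"
    using assms True pos by (simp add: ln_mult ln_powr)
  then show ?thesis using assms True pos by (subst (asm) ln_le_cancel_iff) auto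
qed

text \<open>Bonami's two-point inequality. With \<open>q = p - 1\<close>, the logarithmic derivatives of both sides
  compare through \<open>A * (1 - q * y) \<le> B * (1 + q * y)\<close> for \<open>A = (1 + y) powr q\<close> and
  \<open>B = (1 - y) powr q\<close>; this is the inequality \<open>tanh (q * s) \<le> q * tanh s\<close> with \<open>y = tanh s\<close>.\<close>

lemma two_point_unit:
  fixes p y :: real
  assumes p: "2 \<le> p" and y: "0 \<le> y" "y \<le> 1"
  shows "((1 + y) powr p + (1 - y) powr p) / 2 \<le> (1 + (p - 1) * y\<^sup>2) powr (p / 2)"
proof -
  define q where "q = p - 1"
  have q: "1 \<le> q" "p = q + 1" using p by (auto simp: q_def)
  define W where "W = (\<lambda>x::real. 1 + q * x\<^sup>2)"
  have W: "0 < W x" for x using q by (simp add: W_def add_pos_nonneg)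
  define N where "N = (\<lambda>x. (1 + x) powr p + (1 - x) powr p)"
  \<comment> \<open>The quotient of the two sides up to the factor 2, so that \<open>h 0 = 2\<close>
    and the claim becomes monotonicity of \<open>h\<close>.\<close>
  define h where "h = (\<lambda>x. N x * W x powr (- (p / 2)))"
  \<comment> \<open>Derivatives are taken only at interior points: for \<open>y = 1\<close> the base
    \<open>1 - x\<close> vanishes at the right endpoint, where continuity suffices.\<close>
  have "h y \<le> h 0"
  proof (rule DERIV_nonpos_imp_decreasing_open[of 0 y h])
    fix x assume "0 < x" "x < y"
    then have x: "0 < x" "x < 1" using y by auto
    define A where "A = (1 + x) powr q"
    define B where "B = (1 - x) powr q"
    have AB: "(1 + x) powr p = A * (1 + x)" "(1 - x) powr p = B * (1 - x)"
      using x q by (auto simp: A_def B_def powr_add)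
    have N': "(N has_real_derivative p * (A - B)) (at x)"
    proof -
      have "((\<lambda>x. (1 + x) powr p) has_real_derivative p * (1 + x) powr (p - of_nat 1) * 1) (at x)"
        "((\<lambda>x. (1 - x) powr p) has_real_derivative p * (1 - x) powr (p - of_nat 1) * (- 1)) (at x)"
        using x by (auto intro!: DERIV_fun_powr derivative_eq_intros)
      from DERIV_add[OF this] show ?thesis
        by (simp add: N_def A_def B_def q_def algebra_simps)
    qed
    have W': "((\<lambda>x. W x powr (- (p / 2))) has_real_derivative
        - (p * q * x) * W x powr (- (p / 2) - 1)) (at x)"
    proof -
      have "(W has_real_derivative 2 * q * x) (at x)"
        unfolding W_def by (auto intro!: derivative_eq_intros)
      from DERIV_fun_powr[OF this W, of "- (p / 2)"] show ?thesis by (simp add: algebra_simps)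
    qed
    let ?D = "p * (A - B) * W x powr (- (p / 2)) + - (p * q * x) * W x powr (- (p / 2) - 1) * N x"
    have "(h has_real_derivative ?D) (at x)"
      unfolding h_def by (rule DERIV_mult[OF N' W'])
    moreover have "?D = p * W x powr (- (p / 2) - 1) * ((A - B) * W x - q * x * N x)"
    proof -
      have "W x powr (- (p / 2)) = W x powr (- (p / 2) - 1) * W x"
        using W[of x] by (simp add: powr_diff)
      then show ?thesis by (simp add: algebra_simps)
    qed
    \<comment> \<open>The terms quadratic in \<open>x\<close> cancel, which leaves exactly the
      difference whose sign \<open>powr_odd_even_ratio\<close> controls.\<close>
    moreover have "(A - B) * W x - q * x * N x = A * (1 - q * x) - B * (1 + q * x)"
      unfolding W_def N_def AB by (simp add: algebra_simps power2_eq_square)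
    moreover
    have "A * (1 - q * x) \<le> B * (1 + q * x)"
      unfolding A_def B_def by (rule powr_odd_even_ratio) (use x q in auto)
    then have "p * W x powr (- (p / 2) - 1) * (A * (1 - q * x) - B * (1 + q * x)) \<le> 0"
      using p by (intro mult_nonneg_nonpos) auto
    ultimately show "\<exists>D. (h has_real_derivative D) (at x) \<and> D \<le> 0"
      by (intro exI[of _ ?D] conjI) (simp_all only:)
  next
    show "continuous_on {0..y} h"
      unfolding h_def N_def W_def using y p W[unfolded W_def]
      by (intro continuous_intros continuous_on_powr') (auto simp: less_imp_neq[symmetric] intro: less_imp_le)
  qed (use y in simp)
  then have "N y * W y powr (- (p / 2)) \<le> 2" by (simp add: h_def N_def W_def)
  then have "N y \<le> 2 * W y powr (p / 2)"
    using W[of y] by (simp add: powr_minus field_simps)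
  then show ?thesis by (simp add: N_def W_def q_def)
qed

lemma power2_powr_half: "(x\<^sup>2) powr (p / 2) = \<bar>x\<bar> powr p" for x p :: real
proof (cases "x = 0")
  case False
  then have "x\<^sup>2 = \<bar>x\<bar> powr 2" by simp
  then show ?thesis by (simp only: powr_powr) simp
qed simp

text \<open>Homogeneity reduces the case \<open>\<bar>y\<bar> \<le> \<bar>x\<bar>\<close> to the
  ratio \<open>t\<close> in [0,1]. In the other case \<open>x\<close> and \<open>y\<close> are
  exchanged: the left side is symmetric, and the right side only grows when the weight
  \<open>p - 1 \<ge> 1\<close> falls on the larger square.\<close>

lemma two_point_inequality:
  fixes p x y :: real
  assumes p: "2 \<le> p"
  shows "(\<bar>x + y\<bar> powr p + \<bar>x - y\<bar> powr p) / 2 \<le> (x\<^sup>2 + (p - 1) * y\<^sup>2) powr (p / 2)"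
proof -
  have ordered: "(\<bar>x + y\<bar> powr p + \<bar>x - y\<bar> powr p) / 2 \<le> (x\<^sup>2 + (p - 1) * y\<^sup>2) powr (p / 2)"
    if le: "\<bar>y\<bar> \<le> \<bar>x\<bar>" for x y :: real
  proof (cases "x = 0")
    case True
    then show ?thesis using le by simp
  next
    case False
    define t where "t = \<bar>y\<bar> / \<bar>x\<bar>"
    have t: "0 \<le> t" "t \<le> 1" using le False by (auto simp: t_def field_simps)
    have yt: "\<bar>y\<bar> = \<bar>x\<bar> * t" using False by (simp add: t_def)
    \<comment> \<open>The signs of \<open>x\<close> and \<open>y\<close> only decide which summand
      is which.\<close>
    have "\<bar>x + y\<bar> = \<bar>x\<bar> + \<bar>y\<bar> \<and> \<bar>x - y\<bar> = \<bar>x\<bar> - \<bar>y\<bar> \<or>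
        \<bar>x + y\<bar> = \<bar>x\<bar> - \<bar>y\<bar> \<and> \<bar>x - y\<bar> = \<bar>x\<bar> + \<bar>y\<bar>"
      using le by linarith
    then have "\<bar>x + y\<bar> powr p + \<bar>x - y\<bar> powr p
        = (\<bar>x\<bar> + \<bar>y\<bar>) powr p + (\<bar>x\<bar> - \<bar>y\<bar>) powr p"
      by auto
    also have "\<dots> = (\<bar>x\<bar> * (1 + t)) powr p + (\<bar>x\<bar> * (1 - t)) powr p"
      by (simp add: yt algebra_simps)
    also have "\<dots> = \<bar>x\<bar> powr p * ((1 + t) powr p + (1 - t) powr p)"
      unfolding powr_mult by (simp only: distrib_left)
    finally have "(\<bar>x + y\<bar> powr p + \<bar>x - y\<bar> powr p) / 2
        = \<bar>x\<bar> powr p * (((1 + t) powr p + (1 - t) powr p) / 2)" by simp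
    also have "\<dots> \<le> \<bar>x\<bar> powr p * (1 + (p - 1) * t\<^sup>2) powr (p / 2)"
      using two_point_unit[OF p t] by (intro mult_left_mono) auto
    also have "\<bar>x\<bar> powr p = (x\<^sup>2) powr (p / 2)"
      by (simp add: power2_powr_half)
    also have "(x\<^sup>2) powr (p / 2) * (1 + (p - 1) * t\<^sup>2) powr (p / 2)
        = (x\<^sup>2 + (p - 1) * (\<bar>x\<bar> * t)\<^sup>2) powr (p / 2)"
      by (simp add: algebra_simps power_mult_distrib flip: powr_mult)
    finally show ?thesis by (simp flip: yt)
  qed
  show ?thesis
  proof (cases "\<bar>y\<bar> \<le> \<bar>x\<bar>")
    case True
    then show ?thesis by (rule ordered)
  next
    case False
    then have "(\<bar>y + x\<bar> powr p + \<bar>y - x\<bar> powr p) / 2 \<le> (y\<^sup>2 + (p - 1) * x\<^sup>2) powr (p / 2)"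
      by (intro ordered) simp
    also have "\<dots> \<le> (x\<^sup>2 + (p - 1) * y\<^sup>2) powr (p / 2)"
    proof (rule powr_mono2)
      have "x\<^sup>2 \<le> y\<^sup>2" using False by (simp add: abs_le_square_iff[symmetric])
      then have "(p - 2) * x\<^sup>2 \<le> (p - 2) * y\<^sup>2" using p by (intro mult_left_mono) auto
      then show "y\<^sup>2 + (p - 1) * x\<^sup>2 \<le> x\<^sup>2 + (p - 1) * y\<^sup>2" by (simp add: algebra_simps)
    qed (use p in auto)
    finally show ?thesis by (simp add: add.commute abs_minus_commute)
  qed
qed

section \<open>The L(p) seminorm and Minkowski's inequality\<close>

lemma Lp_norm_nonneg: "0 \<le> Lp_norm M p f"
  by (simp add: Lp_norm_def)

lemma Lp_norm_powr:
  assumes "0 < p"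
  shows "Lp_norm M p f powr p = (\<integral>\<omega>. \<bar>f \<omega>\<bar> powr p \<partial>M)"
  using assms by (simp add: Lp_norm_def powr_powr)

lemma Lp_set_cmult:
  assumes "f \<in> Lp_set M p"
  shows "(\<lambda>\<omega>. c * f \<omega>) \<in> Lp_set M p"
  using assms by (auto simp: Lp_set_def abs_mult powr_mult)

lemma Lp_norm_cmult:
  assumes "0 < p"
  shows "Lp_norm M p (\<lambda>\<omega>. c * f \<omega>) = \<bar>c\<bar> * Lp_norm M p f"
  using assms by (simp add: Lp_norm_def abs_mult powr_mult powr_powr)

text \<open>Minkowski's inequality from convexity: \<open>f / a\<close> and \<open>g / b\<close> are
  combined with weights proportional to \<open>a\<close> and \<open>b\<close>, where
  \<open>a\<close> and \<open>b\<close> are slightly larger than the two norms.\<close>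

lemma Lp_add:
  assumes p: "1 \<le> p" and f: "f \<in> Lp_set M p" and g: "g \<in> Lp_set M p"
  shows "(\<lambda>\<omega>. f \<omega> + g \<omega>) \<in> Lp_set M p"
    and Lp_norm_triangle: "Lp_norm M p (\<lambda>\<omega>. f \<omega> + g \<omega>) \<le> Lp_norm M p f + Lp_norm M p g"
proof -
  have [measurable]: "f \<in> borel_measurable M" "g \<in> borel_measurable M"
    and If: "integrable M (\<lambda>\<omega>. \<bar>f \<omega>\<bar> powr p)" and Ig: "integrable M (\<lambda>\<omega>. \<bar>g \<omega>\<bar> powr p)"
    using f g by (auto simp: Lp_set_def)
  have scaled: "\<bar>u + v\<bar> powr p
      \<le> (a + b) powr p * (a / (a + b) * (\<bar>u\<bar> powr p / a powr p) + b / (a + b) * (\<bar>v\<bar> powr p / b powr p))"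
    if "0 < a" "0 < b" for a b u v :: real
  proof -
    define t where "t = b / (a + b)"
    have t: "0 \<le> t" "t \<le> 1" "1 - t = a / (a + b)" using that by (auto simp: t_def field_simps)
    have "\<bar>(1 - t) * (u / a) + t * (v / b)\<bar> powr p
        \<le> (1 - t) * \<bar>u / a\<bar> powr p + t * \<bar>v / b\<bar> powr p"
      using convex_onD[OF convex_on_abs_powr[OF p] t(1,2), of "u / a" "v / b"] by simp
    moreover have "(1 - t) * (u / a) = u / (a + b)" "t * (v / b) = v / (a + b)"
      using that unfolding t(3) by (simp_all add: t_def)
    then have "u + v = (a + b) * ((1 - t) * (u / a) + t * (v / b))"
      using that by (simp flip: add_divide_distrib)
    then have "\<bar>u + v\<bar> powr p = (a + b) powr p * \<bar>(1 - t) * (u / a) + t * (v / b)\<bar> powr p"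
      using that by (simp add: abs_mult powr_mult)
    ultimately show ?thesis
      using that unfolding t(3) by (simp add: abs_divide powr_divide mult_left_mono t_def)
  qed
  \<comment> \<open>The case \<open>a = b = 1\<close> of \<open>scaled\<close> supplies an
    integrable majorant.\<close>
  have I: "integrable M (\<lambda>\<omega>. \<bar>f \<omega> + g \<omega>\<bar> powr p)"
  proof (rule Bochner_Integration.integrable_bound)
    show "integrable M (\<lambda>\<omega>. 2 powr p * (1 / 2 * (\<bar>f \<omega>\<bar> powr p / 1) + 1 / 2 * (\<bar>g \<omega>\<bar> powr p / 1)))"
      using If Ig by auto
    show "AE \<omega> in M. norm (\<bar>f \<omega> + g \<omega>\<bar> powr p)
        \<le> norm (2 powr p * (1 / 2 * (\<bar>f \<omega>\<bar> powr p / 1) + 1 / 2 * (\<bar>g \<omega>\<bar> powr p / 1)))"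
      using scaled[of 1 1] by (intro AE_I2) simp
  qed simp
  then show "(\<lambda>\<omega>. f \<omega> + g \<omega>) \<in> Lp_set M p" by (simp add: Lp_set_def)
  \<comment> \<open>Strict upper bounds \<open>a\<close>, \<open>b\<close> keep the divisors
    positive even when a norm is zero; the slack is removed at the end by letting \<open>e\<close>
    tend to 0.\<close>
  have bound: "Lp_norm M p (\<lambda>\<omega>. f \<omega> + g \<omega>) \<le> a + b"
    if "Lp_norm M p f < a" "Lp_norm M p g < b" for a b
  proof -
    have ab: "0 < a" "0 < b"
      using that Lp_norm_nonneg[of M p f] Lp_norm_nonneg[of M p g] by linarith+
    have le: "(\<integral>\<omega>. \<bar>f \<omega>\<bar> powr p \<partial>M) / a powr p \<le> 1" "(\<integral>\<omega>. \<bar>g \<omega>\<bar> powr p \<partial>M) / b powr p \<le> 1"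
      using that p ab powr_mono2[of p "Lp_norm M p f" a] powr_mono2[of p "Lp_norm M p g" b]
      by (auto simp: Lp_norm_nonneg Lp_norm_powr)
    have "Lp_norm M p (\<lambda>\<omega>. f \<omega> + g \<omega>) powr p = (\<integral>\<omega>. \<bar>f \<omega> + g \<omega>\<bar> powr p \<partial>M)"
      using p by (simp add: Lp_norm_powr)
    also have "\<dots> \<le> (\<integral>\<omega>. (a + b) powr p * (a / (a + b) * (\<bar>f \<omega>\<bar> powr p / a powr p)
        + b / (a + b) * (\<bar>g \<omega>\<bar> powr p / b powr p)) \<partial>M)"
      using scaled[OF ab] If Ig by (intro integral_mono I) auto
    also have "\<dots> = (a + b) powr p * (a / (a + b) * ((\<integral>\<omega>. \<bar>f \<omega>\<bar> powr p \<partial>M) / a powr p)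
        + b / (a + b) * ((\<integral>\<omega>. \<bar>g \<omega>\<bar> powr p \<partial>M) / b powr p))"
      using If Ig by simp
    also have "\<dots> \<le> (a + b) powr p * (a / (a + b) * 1 + b / (a + b) * 1)"
      using ab le by (intro mult_left_mono add_mono) auto
    also have "\<dots> = (a + b) powr p" using ab by (simp flip: add_divide_distrib)
    finally show ?thesis
      using ab p powr_less_mono2[of p "a + b" "Lp_norm M p (\<lambda>\<omega>. f \<omega> + g \<omega>)"] by force
  qed
  show "Lp_norm M p (\<lambda>\<omega>. f \<omega> + g \<omega>) \<le> Lp_norm M p f + Lp_norm M p g"
  proof (rule field_le_epsilon)
    fix e :: real assume "0 < e"
    then show "Lp_norm M p (\<lambda>\<omega>. f \<omega> + g \<omega>) \<le> Lp_norm M p f + Lp_norm M p g + e"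
      using bound[of "Lp_norm M p f + e / 2" "Lp_norm M p g + e / 2"] by simp
  qed
qed

section \<open>Two-smoothness of the L(p) norm\<close>

lemma Lp_set_power2:
  assumes "f \<in> Lp_set M p"
  shows "(\<lambda>\<omega>. (f \<omega>)\<^sup>2) \<in> Lp_set M (p / 2)"
  using assms by (auto simp: Lp_set_def power2_powr_half)

lemma Lp_norm_power2: "Lp_norm M (p / 2) (\<lambda>\<omega>. (f \<omega>)\<^sup>2) = (Lp_norm M p f)\<^sup>2"
proof -
  have "I powr (1 / (p / 2)) = (I powr (1 / p))\<^sup>2" for I :: real
    unfolding power2_eq_square by (simp flip: powr_add)
  then show ?thesis by (simp only: Lp_norm_def power2_powr_half abs_power2)
qed

text \<open>For \<open>p = 2\<close> this is one half of the parallelogram law; the constant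
  \<open>p - 1\<close> is inherited from the two-point inequality.\<close>

lemma Lp_norm_two_smooth:
  assumes p: "2 \<le> p" and f: "f \<in> Lp_set M p" and g: "g \<in> Lp_set M p"
  shows "(Lp_norm M p (\<lambda>\<omega>. f \<omega> + g \<omega>))\<^sup>2 + (Lp_norm M p (\<lambda>\<omega>. f \<omega> - g \<omega>))\<^sup>2
    \<le> 2 * ((Lp_norm M p f)\<^sup>2 + (p - 1) * (Lp_norm M p g)\<^sup>2)"
proof -
  define A where "A = Lp_norm M p (\<lambda>\<omega>. f \<omega> + g \<omega>)"
  define B where "B = Lp_norm M p (\<lambda>\<omega>. f \<omega> - g \<omega>)"
  define h where "h = (\<lambda>\<omega>. (f \<omega>)\<^sup>2 + (p - 1) * (g \<omega>)\<^sup>2)"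
  have hL: "h \<in> Lp_set M (p / 2)"
    unfolding h_def using p f g by (intro Lp_add Lp_set_cmult Lp_set_power2) auto
  have plus: "(\<lambda>\<omega>. f \<omega> + g \<omega>) \<in> Lp_set M p" and minus: "(\<lambda>\<omega>. f \<omega> - g \<omega>) \<in> Lp_set M p"
    using Lp_add(1)[OF _ f g] Lp_add(1)[OF _ f Lp_set_cmult[OF g, of "-1"]] p by auto
  have h0: "0 \<le> h \<omega>" for \<omega> using p by (simp add: h_def)
  \<comment> \<open>Midpoint convexity, with exponent \<open>p / 2 \<ge> 1\<close>, trades squares
    of norms for their p-th powers, which are integrals.\<close>
  have "((A\<^sup>2 + B\<^sup>2) / 2) powr (p / 2) \<le> (A powr p + B powr p) / 2"
    using convex_onD[OF convex_on_abs_powr[of "p / 2"], of "1 / 2" "A\<^sup>2" "B\<^sup>2"] p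
    by (simp add: power2_powr_half A_def B_def Lp_norm_nonneg add_divide_distrib)
  also have "\<dots> = (\<integral>\<omega>. (\<bar>f \<omega> + g \<omega>\<bar> powr p + \<bar>f \<omega> - g \<omega>\<bar> powr p) / 2 \<partial>M)"
    using p plus minus by (simp add: A_def B_def Lp_norm_powr Lp_set_def)
  also have "\<dots> \<le> (\<integral>\<omega>. \<bar>h \<omega>\<bar> powr (p / 2) \<partial>M)"
    using plus minus hL h0 two_point_inequality[OF p]
    by (intro integral_mono) (auto simp: Lp_set_def h_def)
  also have "\<dots> = Lp_norm M (p / 2) h powr (p / 2)"
    using p by (simp add: Lp_norm_powr)
  \<comment> \<open>The exponent \<open>p / 2\<close> is removed by strict monotonicity of the power
    on nonnegative reals.\<close>
  finally have "(A\<^sup>2 + B\<^sup>2) / 2 \<le> Lp_norm M (p / 2) h"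
    using p powr_less_mono2[of "p / 2" "Lp_norm M (p / 2) h" "(A\<^sup>2 + B\<^sup>2) / 2"]
      Lp_norm_nonneg[of M "p / 2" h] by force
  also have "\<dots> \<le> Lp_norm M (p / 2) (\<lambda>\<omega>. (f \<omega>)\<^sup>2) + Lp_norm M (p / 2) (\<lambda>\<omega>. (p - 1) * (g \<omega>)\<^sup>2)"
    unfolding h_def using p f g by (intro Lp_norm_triangle Lp_set_cmult Lp_set_power2) auto
  also have "\<dots> = (Lp_norm M p f)\<^sup>2 + (p - 1) * (Lp_norm M p g)\<^sup>2"
    using p by (simp add: Lp_norm_cmult Lp_norm_power2)
  finally show ?thesis
    unfolding A_def B_def by (simp only: pos_divide_le_eq zero_less_numeral mult.commute)
qed

section \<open>Adding a conditionally centered increment\<close>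

text \<open>The second differences of \<open>h\<close> make \<open>\<lambda>t. h t - c * t\<^sup>2\<close> midpoint concave, and a minimum at \<open>0\<close>
  forces its slope there to vanish. The function \<open>u\<close> satisfies \<open>u (2 * s) \<le> 2 * u s\<close> and is
  of second order at \<open>0\<close>, hence \<open>u 1 \<le> 0\<close>.\<close>

lemma increment_bound_from_second_differences:
  fixes h :: "real \<Rightarrow> real"
  assumes diff: "\<And>t s. h (t + s) + h (t - s) \<le> 2 * h t + 2 * c * s\<^sup>2"
    and min: "\<And>t. h 0 \<le> h t"
  shows "h 1 \<le> h 0 + c"
proof -
  define u where "u = (\<lambda>t. h t - h 0 - c * t\<^sup>2)"
  have double: "u (2 * s) \<le> 2 * u s" for s
    using diff[of s s] by (simp add: u_def algebra_simps power2_eq_square)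
  \<comment> \<open>The minimum enters here: \<open>h (- s)\<close> is bounded below by
    \<open>h 0\<close>.\<close>
  have small: "u s \<le> c * s\<^sup>2" for s
    using diff[of 0 s] min[of "- s"] by (simp add: u_def)
  have halve: "u 1 \<le> 2 ^ k * u ((1 / 2) ^ k)" for k
  proof (induction k)
    case (Suc k)
    have "u ((1 / 2) ^ k) \<le> 2 * u ((1 / 2) ^ Suc k)"
      using double[of "(1 / 2) ^ Suc k"] by simp
    then have "2 ^ k * u ((1 / 2) ^ k) \<le> 2 ^ k * (2 * u ((1 / 2) ^ Suc k))"
      by (intro mult_left_mono) auto
    also have "\<dots> = 2 ^ Suc k * u ((1 / 2) ^ Suc k)" by simp
    finally show ?case using Suc.IH by linarith
  qed simp
  \<comment> \<open>The \<open>k\<close> doublings cost a factor \<open>2 ^ k\<close>, while the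
    quadratic bound at \<open>(1 / 2) ^ k\<close> gains \<open>4 ^ k\<close>.\<close>
  have "u 1 \<le> c * (1 / 2) ^ k" for k
  proof -
    have "2 ^ k * u ((1 / 2) ^ k) \<le> 2 ^ k * (c * ((1 / 2) ^ k)\<^sup>2)"
      using small by (intro mult_left_mono) auto
    also have "\<dots> = (2 * (1 / 2)) ^ k * (c * (1 / 2) ^ k)"
      unfolding power_mult_distrib power2_eq_square by (simp only: mult_ac)
    finally show ?thesis using halve[of k] by simp
  qed
  moreover have "(\<lambda>k. c * (1 / 2) ^ k) \<longlonglongrightarrow> c * 0"
    by (rule tendsto_mult[OF tendsto_const LIMSEQ_power_zero]) simp
  ultimately have "u 1 \<le> 0"
    by (intro LIMSEQ_le_const[where X = "\<lambda>k. c * (1 / 2) ^ k"]) auto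
  then show ?thesis by (simp add: u_def)
qed

text \<open>The slope \<open>w\<close> of the tangent at \<open>f\<close> is
  \<open>F\<close>-measurable, so the integral of \<open>w * g\<close> equals that of
  \<open>w\<close> times the conditional expectation of \<open>g\<close>, which is zero. Integrating
  the tangent inequality gives the claim.\<close>

lemma (in sigma_finite_subalgebra) Lp_norm_add_cond_centered_ge:
  assumes p: "1 \<le> p" and f: "f \<in> Lp_set M p" and fF: "f \<in> borel_measurable F"
    and g: "g \<in> Lp_set M p" and g0: "AE \<omega> in M. real_cond_exp M F g \<omega> = 0"
  shows "Lp_norm M p f \<le> Lp_norm M p (\<lambda>\<omega>. f \<omega> + g \<omega>)"
proof -
  have [measurable]: "f \<in> borel_measurable M" "g \<in> borel_measurable M" "f \<in> borel_measurable F"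
    and If: "integrable M (\<lambda>\<omega>. \<bar>f \<omega>\<bar> powr p)"
    using f g fF by (auto simp: Lp_set_def)
  define w where "w = (\<lambda>\<omega>. p * (sgn (f \<omega>) * \<bar>f \<omega>\<bar> powr (p - 1)))"
  have [measurable]: "w \<in> borel_measurable F" "w \<in> borel_measurable M" by (auto simp: w_def)
  have fg: "(\<lambda>\<omega>. f \<omega> + g \<omega>) \<in> Lp_set M p" and fg': "(\<lambda>\<omega>. f \<omega> - g \<omega>) \<in> Lp_set M p"
    using Lp_add(1)[OF p f g] Lp_add(1)[OF p f Lp_set_cmult[OF g, of "-1"]] by auto
  have lower: "\<bar>f \<omega>\<bar> powr p + w \<omega> * g \<omega> \<le> \<bar>f \<omega> + g \<omega>\<bar> powr p"
    and upper: "\<bar>f \<omega>\<bar> powr p - w \<omega> * g \<omega> \<le> \<bar>f \<omega> - g \<omega>\<bar> powr p" for \<omega>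
    using abs_powr_tangent[OF p, of "f \<omega>" "f \<omega> + g \<omega>"] abs_powr_tangent[OF p, of "f \<omega>" "f \<omega> - g \<omega>"]
    by (auto simp: w_def)
  \<comment> \<open>The tangent at \<open>f\<close>, evaluated at \<open>f + g\<close> and at
    \<open>f - g\<close>, bounds \<open>w * g\<close> from above and from below by integrable
    functions.\<close>
  have Iw: "integrable M (\<lambda>\<omega>. w \<omega> * g \<omega>)"
  proof (rule Bochner_Integration.integrable_bound)
    show "integrable M (\<lambda>\<omega>. \<bar>f \<omega> + g \<omega>\<bar> powr p + \<bar>f \<omega> - g \<omega>\<bar> powr p)"
      using fg fg' by (auto simp: Lp_set_def)
    show "AE \<omega> in M. norm (w \<omega> * g \<omega>) \<le> norm (\<bar>f \<omega> + g \<omega>\<bar> powr p + \<bar>f \<omega> - g \<omega>\<bar> powr p)"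
    proof (rule AE_I2)
      fix \<omega>
      have "0 \<le> \<bar>f \<omega>\<bar> powr p" "0 \<le> \<bar>f \<omega> + g \<omega>\<bar> powr p" "0 \<le> \<bar>f \<omega> - g \<omega>\<bar> powr p" by auto
      then show "norm (w \<omega> * g \<omega>) \<le> norm (\<bar>f \<omega> + g \<omega>\<bar> powr p + \<bar>f \<omega> - g \<omega>\<bar> powr p)"
        using lower[of \<omega>] upper[of \<omega>] unfolding real_norm_def by linarith
    qed
  qed simp
  have "(\<integral>\<omega>. w \<omega> * g \<omega> \<partial>M) = (\<integral>\<omega>. w \<omega> * real_cond_exp M F g \<omega> \<partial>M)"
    using Iw by (intro real_cond_exp_intg(2)[symmetric]) auto
  also have "\<dots> = (\<integral>\<omega>. 0 \<partial>M)"
    using g0 by (intro integral_cong_AE) auto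
  finally have "(\<integral>\<omega>. w \<omega> * g \<omega> \<partial>M) = 0" by simp
  then have "(\<integral>\<omega>. \<bar>f \<omega>\<bar> powr p \<partial>M) = (\<integral>\<omega>. \<bar>f \<omega>\<bar> powr p + w \<omega> * g \<omega> \<partial>M)"
    using If Iw by simp
  also have "\<dots> \<le> (\<integral>\<omega>. \<bar>f \<omega> + g \<omega>\<bar> powr p \<partial>M)"
    using If Iw fg lower by (intro integral_mono) (auto simp: Lp_set_def)
  finally show ?thesis
    unfolding Lp_norm_def using p by (intro powr_mono2) auto
qed

lemma (in sigma_finite_subalgebra) Lp_norm_add_cond_centered_le:
  assumes p: "2 \<le> p" and f: "f \<in> Lp_set M p" and fF: "f \<in> borel_measurable F"
    and g: "g \<in> Lp_set M p" "integrable M g" and g0: "AE \<omega> in M. real_cond_exp M F g \<omega> = 0"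
  shows "(Lp_norm M p (\<lambda>\<omega>. f \<omega> + g \<omega>))\<^sup>2 \<le> (Lp_norm M p f)\<^sup>2 + (p - 1) * (Lp_norm M p g)\<^sup>2"
proof -
  define h where "h = (\<lambda>t. (Lp_norm M p (\<lambda>\<omega>. f \<omega> + t * g \<omega>))\<^sup>2)"
  have "h 1 \<le> h 0 + (p - 1) * (Lp_norm M p g)\<^sup>2"
  proof (rule increment_bound_from_second_differences)
    fix t s :: real
    have "(\<lambda>\<omega>. f \<omega> + t * g \<omega>) \<in> Lp_set M p"
      using p f g by (intro Lp_add Lp_set_cmult) auto
    from Lp_norm_two_smooth[OF p this Lp_set_cmult[OF g(1), of s]]
    show "h (t + s) + h (t - s) \<le> 2 * h t + 2 * ((p - 1) * (Lp_norm M p g)\<^sup>2) * s\<^sup>2"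
      using p by (simp add: h_def Lp_norm_cmult algebra_simps)
  next
    \<comment> \<open>Every multiple \<open>t * g\<close> is again conditionally centered, so the
      minimum over the whole line lies at \<open>t = 0\<close>.\<close>
    fix t :: real
    have "AE \<omega> in M. real_cond_exp M F (\<lambda>\<omega>. t * g \<omega>) \<omega> = t * real_cond_exp M F g \<omega>"
      using g(2) by (rule real_cond_exp_cmult)
    then have "AE \<omega> in M. real_cond_exp M F (\<lambda>\<omega>. t * g \<omega>) \<omega> = 0"
      using g0 by eventually_elim simp
    then have "Lp_norm M p f \<le> Lp_norm M p (\<lambda>\<omega>. f \<omega> + t * g \<omega>)"
      using p f fF g by (intro Lp_norm_add_cond_centered_ge Lp_set_cmult) auto
    then show "h 0 \<le> h t" by (simp add: h_def Lp_norm_nonneg power_mono)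
  qed
  then show ?thesis by (simp add: h_def)
qed

section \<open>Summation along the filtration\<close>

lemma filtration_upto_mono:
  assumes "filtration_upto M n F" "i \<le> j" "j \<le> n"
  shows "subalgebra (F j) (F i)"
proof -
  have "sets (F i) \<subseteq> sets (F j)"
    using assms(2,3)
  proof (induction j rule: dec_induct)
    case (step j)
    then have "sets (F i) \<subseteq> sets (F j)" "sets (F j) \<subseteq> sets (F (Suc j))"
      using assms(1) unfolding filtration_upto_def by auto
    then show ?case by (rule order_trans)
  qed simp
  moreover have "space (F i) = space (F j)"
    using assms unfolding filtration_upto_def subalgebra_def by (metis order_trans)
  ultimately show ?thesis by (simp add: subalgebra_def)
qed

text \<open>Membership in L(p) and measurability of the partial sum are carried through the
  induction because the increment bound requires both at the next step.\<close>

lemma martingale_Lp_norm_sum_le: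
  assumes M: "prob_space M" and p: "2 \<le> p" and F: "filtration_upto M n F"
    and md: "centered_martingale_differences M n F \<xi>"
    and Lp: "\<And>i. i \<in> {1..n} \<Longrightarrow> \<xi> i \<in> Lp_set M p"
    and "m \<le> n"
  shows "(\<lambda>\<omega>. \<Sum>i=1..m. \<xi> i \<omega>) \<in> Lp_set M p \<and>
    (\<lambda>\<omega>. \<Sum>i=1..m. \<xi> i \<omega>) \<in> borel_measurable (F m) \<and>
    (Lp_norm M p (\<lambda>\<omega>. \<Sum>i=1..m. \<xi> i \<omega>))\<^sup>2 \<le> (p - 1) * (\<Sum>i=1..m. (Lp_norm M p (\<xi> i))\<^sup>2)"
  using \<open>m \<le> n\<close>
proof (induction m)
  case 0
  then show ?case using p by (simp add: Lp_set_def Lp_norm_def)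
next
  case (Suc m)
  define S where "S = (\<lambda>\<omega>. \<Sum>i=1..m. \<xi> i \<omega>)"
  have S: "S \<in> Lp_set M p" "S \<in> borel_measurable (F m)"
    and S_le: "(Lp_norm M p S)\<^sup>2 \<le> (p - 1) * (\<Sum>i=1..m. (Lp_norm M p (\<xi> i))\<^sup>2)"
    using Suc by (auto simp: S_def)
  have \<xi>: "\<xi> (Suc m) \<in> Lp_set M p" "integrable M (\<xi> (Suc m))" "\<xi> (Suc m) \<in> borel_measurable (F (Suc m))"
      "AE \<omega> in M. real_cond_exp M (F m) (\<xi> (Suc m)) \<omega> = 0"
    using md Lp Suc.prems by (auto simp: centered_martingale_differences_def)
  interpret prob_space M by (rule M)
  have "subalgebra M (F m)" using F Suc.prems by (auto simp: filtration_upto_def)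
  \<comment> \<open>Finiteness of the measure makes \<open>F m\<close> a sigma-finite subalgebra,
    the setting of the increment bound.\<close>
  then interpret finite_measure_subalgebra M "F m" by unfold_locales
  have "S \<in> borel_measurable (F (Suc m))"
    using measurable_from_subalg[OF filtration_upto_mono[OF F, of m "Suc m"] S(2)] Suc.prems by simp
  moreover have "(Lp_norm M p (\<lambda>\<omega>. S \<omega> + \<xi> (Suc m) \<omega>))\<^sup>2
      \<le> (Lp_norm M p S)\<^sup>2 + (p - 1) * (Lp_norm M p (\<xi> (Suc m)))\<^sup>2"
    using p S \<xi> by (intro Lp_norm_add_cond_centered_le) auto
  moreover have "(\<lambda>\<omega>. S \<omega> + \<xi> (Suc m) \<omega>) \<in> Lp_set M p"
    using p S \<xi> by (intro Lp_add) auto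
  moreover have "(\<lambda>\<omega>. \<Sum>i=1..Suc m. \<xi> i \<omega>) = (\<lambda>\<omega>. S \<omega> + \<xi> (Suc m) \<omega>)"
    by (simp add: S_def)
  ultimately show ?case
    using S_le \<xi>(3) by (simp add: algebra_simps)
qed

text \<open>Membership in \<open>Lp_set\<close> accompanies the bound because \<open>Lp_norm\<close>
  takes the value 0 when the p-th power is not integrable.\<close>

theorem theorem2p1:
  fixes M :: "'a measure" and p :: real and n :: nat
    and F :: "nat \<Rightarrow> 'a measure" and \<xi> :: "nat \<Rightarrow> 'a \<Rightarrow> real"
  assumes "prob_space M"
    and "2 \<le> p"
    and "1 \<le> n"
    and "filtration_upto M n F"
    and "centered_martingale_differences M n F \<xi>"
    and "\<And>i. i \<in> {1..n} \<Longrightarrow> \<xi> i \<in> Lp_set M p"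
  shows "(\<lambda>\<omega>. real n powr (- 1 / 2) * (\<Sum>i=1..n. \<xi> i \<omega>)) \<in> Lp_set M p \<and>
         Lp_norm M p (\<lambda>\<omega>. real n powr (- 1 / 2) * (\<Sum>i=1..n. \<xi> i \<omega>))
           \<le> (p - 1) * (1 / real n * (\<Sum>i=1..n. (Lp_norm M p (\<xi> i))\<^sup>2)) powr (1 / 2)"
proof -
  define S where "S = (\<lambda>\<omega>. \<Sum>i=1..n. \<xi> i \<omega>)"
  define V where "V = (\<Sum>i=1..n. (Lp_norm M p (\<xi> i))\<^sup>2)"
  have S: "S \<in> Lp_set M p" and le: "(Lp_norm M p S)\<^sup>2 \<le> (p - 1) * V"
    using martingale_Lp_norm_sum_le[OF assms(1,2,4-6) order_refl] by (simp_all add: S_def V_def)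
  have V: "0 \<le> V" by (simp add: V_def sum_nonneg)
  \<comment> \<open>Since \<open>1 \<le> p - 1\<close>, the factor may be squared; this weakens the
    constant \<open>sqrt (p - 1)\<close> to \<open>p - 1\<close>.\<close>
  have "(p - 1) * V \<le> (p - 1)\<^sup>2 * V"
    using V assms(2) by (intro mult_right_mono) (auto simp: power2_eq_square)
  with le have "(Lp_norm M p S)\<^sup>2 \<le> (p - 1)\<^sup>2 * V" by simp
  then have "Lp_norm M p S \<le> sqrt ((p - 1)\<^sup>2 * V)" by (rule real_le_rsqrt)
  then have norm_le: "Lp_norm M p S \<le> (p - 1) * sqrt V"
    using assms(2) by (simp add: real_sqrt_mult)
  have "real n powr (- 1 / 2) * Lp_norm M p S \<le> real n powr (- 1 / 2) * ((p - 1) * sqrt V)"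
    by (intro mult_left_mono norm_le) simp
  also have "\<dots> = (p - 1) * (1 / real n * V) powr (1 / 2)"
  proof -
    have "real n powr (- 1 / 2) = (1 / real n) powr (1 / 2)"
      by (simp add: powr_divide powr_minus_divide)
    moreover have "sqrt V = V powr (1 / 2)" using V by (simp add: powr_half_sqrt)
    ultimately show ?thesis unfolding powr_mult by (simp only: mult_ac)
  qed
  finally show ?thesis
    using S assms(2) Lp_set_cmult[OF S, of "real n powr (- 1 / 2)"]
    by (simp add: Lp_norm_cmult S_def V_def)
qed

end
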